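(* Let $a$ be a positive integer and let $p$ be a prime with $p\geq 2a+2$. Then $$\sum_{i=1}^{p-1}\left(H_i^{(a)}\right)^2\equiv-2\sum_{i=1}^{p-1}i^{-a+1}H_i^{(a)}\pmod{p^2}.$$
   Context: For an integer $r$ and a positive integer $n$, $H_n^{(r)}=\sum_{k=1}^n k^{-r}$ is the generalized harmonic number. Congruences are between rational numbers whose denominators are not divisible by $p$: $\frac mn\equiv\frac rs \pmod{p^k}$ means $ms\equiv nr\pmod{p^k}$, where $n,s$ are not divisible by $p$. *)

theory Defs
  imports Complex_Main "HOL-Number_Theory.Number_Theory"
begin

definition gen_harmonic :: "int \<Rightarrow> nat \<Rightarrow> rat" where
  "gen_harmonic r n = (\<Sum>k=1..n. of_nat k powi (- r))"

text \<open>
  Congruence of rational numbers modulo the prime power \<open>p ^ k\<close>. Being congruent includes that both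
  numbers have a denominator not divisible by \<open>p\<close>. The fractions need not be in lowest terms: for
  prime \<open>p\<close> the congruence does not depend on the chosen representations.
\<close>
definition rat_cong :: "nat \<Rightarrow> nat \<Rightarrow> rat \<Rightarrow> rat \<Rightarrow> bool" where
  "rat_cong p k x y \<longleftrightarrow>
     (\<exists>m n r s :: int. \<not> int p dvd n \<and> \<not> int p dvd s \<and>
        x = of_int m / of_int n \<and> y = of_int r / of_int s \<and>
        [m * s = n * r] (mod (int p ^ k)))"

end

theory Submission
  imports Defs
begin

text \<open>
  Write \<open>H\<^sub>i\<close> for the generalized harmonic numbers of order \<open>a\<close>.
  Abel summation, comparing \<open>i H\<^sub>i\<^sup>2\<close> with \<open>(i - 1) H\<^sub>i\<^sub>-\<^sub>1\<^sup>2\<close>, turns the claim into a closed form that is exact over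
  the rationals (\<open>sum_gen_harmonic_square\<close>): the difference of the two sides of the congruence is
  \<open>p H\<^sup>2 + K\<close>, where \<open>H\<close> and \<open>K\<close> are the harmonic numbers of index \<open>p - 1\<close> and of orders \<open>a\<close> and
  \<open>2 a - 1\<close>. Both terms vanish modulo \<open>p\<^sup>2\<close>.

  For the first, \<open>p\<close> divides \<open>H\<close> (\<open>pdiv_1_gen_harmonic\<close>), because the sum of the inverse \<open>m\<close>-th powers of all
  nonzero residues is unchanged when the residues are multiplied by some \<open>g\<close>, which also
  divides it by \<open>g\<^sup>m\<close>; if \<open>0 < m < p - 1\<close>, then \<open>g\<close> can be chosen with \<open>g\<^sup>m\<close> not congruent to 1.

  For the second, the order \<open>2 a - 1\<close> is odd (\<open>pdiv_2_gen_harmonic\<close>): pairing \<open>i\<close> with \<open>p - i\<close> cancels the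
  constant terms in an expansion in powers of \<open>p\<close>, and the linear term is a multiple of
  \<open>p\<close> times the harmonic number of order \<open>2 a\<close>, which is again divisible by \<open>p\<close>, since \<open>2 a < p - 1\<close>.
\<close>

section \<open>Rational numbers divisible by a power of a prime\<close>

text \<open>
  For prime \<open>p\<close> this is the ideal generated by \<open>p ^ k\<close> in the localization of the integers at \<open>p\<close>; the
  case \<open>k = 0\<close> is the localization itself, so that integrality and divisibility share
  their closure properties.
\<close>
definition pdiv :: "nat \<Rightarrow> nat \<Rightarrow> rat \<Rightarrow> bool" where
  "pdiv p k x \<longleftrightarrow> (\<exists>m n :: int. \<not> int p dvd n \<and> x = of_int (int p ^ k * m) / of_int n)"

lemma pdivI:
  assumes "\<not> int p dvd n" "int p ^ k dvd m" "x = of_int m / of_int n"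
  shows "pdiv p k x"
proof -
  obtain c where "m = int p ^ k * c"
    using assms(2) by (elim dvdE)
  then show ?thesis
    using assms(1,3) unfolding pdiv_def by blast
qed

lemma pdiv_0 [simp]: "p \<ge> 2 \<Longrightarrow> pdiv p k 0"
  by (rule pdivI[of p 1 k 0]) auto

lemma pdiv_of_int: "p \<ge> 2 \<Longrightarrow> pdiv p 0 (of_int x)"
  by (rule pdivI[of p 1 0 x]) auto

lemma pdiv_prime: "p \<ge> 2 \<Longrightarrow> pdiv p 1 (of_nat p)"
  by (rule pdivI[of p 1 1 "int p"]) auto

lemma pdiv_inverse:
  assumes "\<not> int p dvd x"
  shows "pdiv p 0 (inverse (of_int x))"
  by (rule pdivI[of p x 0 1]) (use assms in \<open>auto simp: field_simps\<close>)

lemma pdiv_mult: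
  assumes "prime p" "pdiv p k x" "pdiv p l y"
  shows "pdiv p (k + l) (x * y)"
proof -
  obtain a b where 1: "\<not> int p dvd b" "x = of_int (int p ^ k * a) / of_int b"
    using assms unfolding pdiv_def by blast
  obtain c d where 2: "\<not> int p dvd d" "y = of_int (int p ^ l * c) / of_int d"
    using assms unfolding pdiv_def by blast
  show ?thesis
  proof (rule pdivI)
    show "\<not> int p dvd b * d"
      using 1 2 assms(1) by (simp add: prime_dvd_mult_iff)
    show "int p ^ (k + l) dvd int p ^ k * a * (int p ^ l * c)"
      by (simp add: power_add mult_dvd_mono)
  qed (simp add: 1 2)
qed

lemma pdiv_add:
  assumes "prime p" "pdiv p k x" "pdiv p k y"
  shows "pdiv p k (x + y)"
proof -
  obtain a b where 1: "\<not> int p dvd b" "x = of_int (int p ^ k * a) / of_int b"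
    using assms unfolding pdiv_def by blast
  obtain c d where 2: "\<not> int p dvd d" "y = of_int (int p ^ k * c) / of_int d"
    using assms unfolding pdiv_def by blast
  have "b \<noteq> 0" "d \<noteq> 0"
    using 1 2 by auto
  show ?thesis
  proof (rule pdivI)
    show "\<not> int p dvd b * d"
      using 1 2 assms(1) by (simp add: prime_dvd_mult_iff)
    show "int p ^ k dvd int p ^ k * a * d + int p ^ k * c * b"
      by simp
    show "x + y = of_int (int p ^ k * a * d + int p ^ k * c * b) / of_int (b * d)"
      using \<open>b \<noteq> 0\<close> \<open>d \<noteq> 0\<close> by (simp add: 1 2 add_frac_eq)
  qed
qed

lemma pdiv_uminus:
  assumes "prime p" "pdiv p k x"
  shows "pdiv p k (- x)"
  using pdiv_mult[OF assms(1) pdiv_of_int[of p "-1"] assms(2)] assms(1)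
  by (simp add: prime_ge_2_nat)

lemma pdiv_diff:
  assumes "prime p" "pdiv p k x" "pdiv p k y"
  shows "pdiv p k (x - y)"
  using pdiv_add[OF assms(1,2) pdiv_uminus[OF assms(1,3)]] by simp

lemma pdiv_sum:
  assumes "prime p" "\<And>i. i \<in> A \<Longrightarrow> pdiv p k (f i)"
  shows "pdiv p k (\<Sum>i\<in>A. f i)"
  using assms(2)
  by (induction A rule: infinite_finite_induct)
     (auto intro!: pdiv_add[OF assms(1)] pdiv_0 prime_ge_2_nat[OF assms(1)])

lemma pdiv_cancel:
  assumes "prime p" "pdiv p k (of_int c * x)" "\<not> int p dvd c"
  shows "pdiv p k x"
proof -
  have "c \<noteq> 0"
    using assms by auto
  then show ?thesis
    using pdiv_mult[OF assms(1) pdiv_inverse[OF assms(3)] assms(2)]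
    by (simp flip: mult.assoc)
qed

text \<open>
  Integrality is asked of one side only: the other side then differs from it by an integral number.
\<close>
lemma rat_congI:
  assumes "prime p" "pdiv p 0 y" "pdiv p k (x - y)"
  shows "rat_cong p k x y"
proof -
  obtain r s where 1: "\<not> int p dvd s" "y = of_int r / of_int s"
    using assms(2) unfolding pdiv_def by auto
  obtain u v where 2: "\<not> int p dvd v" "x - y = of_int (int p ^ k * u) / of_int v"
    using assms(3) unfolding pdiv_def by blast
  have nz: "s \<noteq> 0" "v \<noteq> 0"
    using 1 2 by auto
  have "x = of_int (int p ^ k * u) / of_int v + of_int r / of_int s"
    using 1(2) 2(2) by (simp add: algebra_simps)
  also have "\<dots> = of_int (int p ^ k * u * s + r * v) / of_int (v * s)"
    using nz by (simp add: add_frac_eq)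
  finally have x: "x = of_int (int p ^ k * u * s + r * v) / of_int (v * s)" .
  have "(int p ^ k * u * s + r * v) * s - v * s * r = int p ^ k * (u * s * s)"
    by (simp add: algebra_simps)
  then have "[(int p ^ k * u * s + r * v) * s = v * s * r] (mod int p ^ k)"
    by (simp add: cong_iff_dvd_diff)
  moreover have "\<not> int p dvd v * s"
    using 1 2 assms(1) by (simp add: prime_dvd_mult_iff)
  ultimately show ?thesis
    unfolding rat_cong_def using x 1 by blast
qed

section \<open>Harmonic numbers of index p - 1\<close>

lemma gen_harmonic_nat: "gen_harmonic (int m) n = (\<Sum>k=1..n. inverse (of_nat k ^ m))"
  unfolding gen_harmonic_def by (simp add: power_int_minus)

lemma gen_harmonic_Suc:
  "gen_harmonic (int m) (Suc n) = gen_harmonic (int m) n + inverse (of_nat (Suc n) ^ m)"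
  unfolding gen_harmonic_nat by simp

lemma gen_harmonic_0 [simp]: "gen_harmonic r 0 = 0"
  unfolding gen_harmonic_def by simp

lemma pdiv_inverse_power:
  assumes "prime p" "k \<in> {1..p - 1}"
  shows "pdiv p 0 (inverse (of_nat k ^ m))"
proof -
  have "\<not> p dvd k"
    using assms(2) by (auto dest: dvd_imp_le)
  then have "\<not> int p dvd int k ^ m"
    using assms(1) by (auto dest: prime_dvd_power[rotated] simp: prime_nat_int_transfer)
  from pdiv_inverse[OF this] show ?thesis
    by simp
qed

lemma pdiv_gen_harmonic:
  assumes "prime p" "n < p"
  shows "pdiv p 0 (gen_harmonic (int m) n)"
  unfolding gen_harmonic_nat
  by (intro pdiv_sum pdiv_inverse_power assms) (use assms(2) in auto)

lemma pdiv_inverse_cong: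
  assumes "prime p" "[a = b] (mod int p)" "\<not> int p dvd b"
  shows "pdiv p 1 (inverse (of_int a) - inverse (of_int b))"
proof -
  have a: "\<not> int p dvd a"
    using assms(2,3) cong_dvd_iff by blast
  have nz: "a \<noteq> 0" "b \<noteq> 0"
    using a assms(3) by auto
  show ?thesis
  proof (rule pdivI)
    show "\<not> int p dvd a * b"
      using a assms by (simp add: prime_dvd_mult_iff)
    show "int p ^ 1 dvd b - a"
      using assms(2) by (simp add: cong_iff_dvd_diff dvd_diff_commute)
  qed (use nz in \<open>simp add: field_simps\<close>)
qed

text \<open>A primitive root has this property for every such exponent, its order being \<open>p - 1\<close>.\<close>
lemma exists_nontrivial_power_residue:
  fixes p m :: nat
  assumes "prime p" "0 < m" "m < p - 1"
  shows "\<exists>g. \<not> p dvd g \<and> \<not> [g ^ m = 1] (mod p)"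
proof -
  obtain g where g: "residue_primroot p g"
    using prime_primitive_root_exists[of p] assms(1) prime_gt_1_nat by blast
  then have "coprime p g" "ord p g = p - 1"
    using assms(1) by (auto simp: residue_primroot_def totient_prime)
  moreover have "\<not> p - 1 dvd m"
    using assms(2,3) by (auto dest: dvd_imp_le)
  ultimately have "\<not> [g ^ m = 1] (mod p)"
    by (metis ord_divides)
  moreover have "\<not> p dvd g"
    using \<open>coprime p g\<close> assms(1) coprime_absorb_left not_prime_unit by blast
  ultimately show ?thesis by blast
qed

lemma bij_betw_mult_mod:
  fixes p g :: nat
  assumes "prime p" "\<not> p dvd g"
  shows "bij_betw (\<lambda>i. g * i mod p) {1..p - 1} {1..p - 1}"
proof -
  have p: "p > 1"
    using assms(1) by (rule prime_gt_1_nat)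
  have inj: "inj_on (\<lambda>i. g * i mod p) {1..p - 1}"
  proof (rule inj_onI)
    fix i j assume ij: "i \<in> {1..p - 1}" "j \<in> {1..p - 1}" "g * i mod p = g * j mod p"
    have "coprime g p"
      using assms prime_imp_coprime coprime_commute by blast
    then have "[i = j] (mod p)"
      using ij(3) cong_mult_lcancel_nat by (simp add: cong_def)
    then show "i = j"
      using ij(1,2) p by (auto simp: cong_def)
  qed
  have "g * i mod p \<in> {1..p - 1}" if "i \<in> {1..p - 1}" for i
  proof -
    have "\<not> p dvd i"
      using that by (auto dest: dvd_imp_le)
    then have "\<not> p dvd g * i"
      using assms by (simp add: prime_dvd_mult_iff)
    then have "g * i mod p > 0"
      by (simp add: mod_greater_zero_iff_not_dvd)
    moreover have "g * i mod p < p"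
      using p by simp
    ultimately show ?thesis
      by simp
  qed
  then have "(\<lambda>i. g * i mod p) ` {1..p - 1} \<subseteq> {1..p - 1}"
    by blast
  from endo_inj_surj[OF _ this inj] show ?thesis
    using inj by (simp add: bij_betw_def)
qed

text \<open>
  With \<open>g\<close> as above, substituting \<open>g * i mod p\<close> for \<open>i\<close> permutes the summands, while modulo \<open>p\<close> it multiplies
  the sum by \<open>g\<close> to the power \<open>- m\<close>. Hence \<open>g ^ m - 1\<close> times the sum is divisible by \<open>p\<close>.
\<close>
lemma pdiv_1_gen_harmonic:
  fixes p m :: nat
  assumes "prime p" "0 < m" "m < p - 1"
  shows "pdiv p 1 (gen_harmonic (int m) (p - 1))"
proof -
  let ?H = "gen_harmonic (int m) (p - 1)"
  obtain g where g: "\<not> p dvd g" "\<not> [g ^ m = 1] (mod p)"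
    using exists_nontrivial_power_residue[OF assms] by blast
  have "g \<noteq> 0"
    using g(1) by (metis dvd_0_right)
  have "(\<Sum>i=1..p - 1. inverse (of_nat (g * i mod p) ^ m)) = ?H"
    unfolding gen_harmonic_nat
    by (rule sum.reindex_bij_betw[OF bij_betw_mult_mod[OF assms(1) g(1)]])
  moreover have "(\<Sum>i=1..p - 1. inverse (of_nat (g * i) ^ m)) = inverse (of_nat g ^ m) * ?H"
    unfolding gen_harmonic_nat by (simp add: sum_distrib_left power_mult_distrib)
  ultimately have eq: "(\<Sum>i=1..p - 1. inverse (of_nat (g * i mod p) ^ m) - inverse (of_nat (g * i) ^ m))
      = ?H - inverse (of_nat g ^ m) * ?H"
    by (simp add: sum_subtractf)
  have "pdiv p 1 (\<Sum>i=1..p - 1. inverse (of_nat (g * i mod p) ^ m) - inverse (of_nat (g * i) ^ m))"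
  proof (rule pdiv_sum[OF assms(1)])
    fix i assume i: "i \<in> {1..p - 1}"
    then have "\<not> p dvd i"
      by (auto dest: dvd_imp_le)
    then have "\<not> p dvd (g * i) ^ m"
      using g(1) prime_dvd_power[OF assms(1)] prime_dvd_mult_iff[OF assms(1)] by blast
    then have "\<not> int p dvd int ((g * i) ^ m)"
      by (simp only: int_dvd_int_iff not_False_eq_True)
    moreover have "[int ((g * i mod p) ^ m) = int ((g * i) ^ m)] (mod int p)"
      unfolding cong_int_iff by (intro cong_pow) (simp add: cong_def)
    ultimately have "pdiv p 1 (inverse (of_int (int ((g * i mod p) ^ m)))
        - inverse (of_int (int ((g * i) ^ m))))"
      using pdiv_inverse_cong[OF assms(1)] by blast
    then show "pdiv p 1 (inverse (of_nat (g * i mod p) ^ m) - inverse (of_nat (g * i) ^ m))"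
      by (simp only: of_int_of_nat_eq of_nat_power of_int_power)
  qed
  then have "pdiv p 1 (?H - inverse (of_nat g ^ m) * ?H)"
    by (simp only: eq)
  then have "pdiv p 1 (of_int (int g ^ m) * (?H - inverse (of_nat g ^ m) * ?H))"
    using pdiv_mult[OF assms(1) pdiv_of_int[of p "int g ^ m"]] assms(1)
    by (metis add_0 prime_ge_2_nat)
  moreover have "of_int (int g ^ m) * (?H - inverse (of_nat g ^ m) * ?H) = of_int (int g ^ m - 1) * ?H"
    using \<open>g \<noteq> 0\<close> by (simp add: field_simps)
  moreover have "\<not> int p dvd int g ^ m - 1"
    using g(2) by (metis cong_iff_dvd_diff cong_int_iff of_nat_1 of_nat_power)
  ultimately show ?thesis
    using pdiv_cancel[OF assms(1)] by metis
qed

text \<open>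
  This is the first-order expansion of the power \<open>- m\<close> of \<open>x - q\<close>, namely
  \<open>(x - q) powi (- m) \<equiv> x powi (- m) + q * m * x powi (- m - 1)\<close> modulo \<open>q\<^sup>2\<close>, with the denominators cleared.
  In this form the induction needs only
  \<open>(x + q * (m + 1)) * (x - q) = x * (x + q * m) - q\<^sup>2 * (m + 1)\<close>.
\<close>
lemma inverse_power_expansion_mod_square:
  fixes x q :: int
  shows "q\<^sup>2 dvd (x + q * int m) * (x - q) ^ m - x ^ Suc m"
proof (induction m)
  case (Suc m)
  have "(x + q * int (Suc m)) * (x - q) ^ Suc m - x ^ Suc (Suc m)
      = x * ((x + q * int m) * (x - q) ^ m - x ^ Suc m) - q\<^sup>2 * (int (Suc m) * (x - q) ^ m)"
    by (simp add: algebra_simps power2_eq_square)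
  then show ?case
    using Suc by (simp only: dvd_diff dvd_mult dvd_triv_left)
qed simp

lemma pdiv_2_inverse_power_shift:
  assumes "prime p" "\<not> int p dvd x"
  shows "pdiv p 2 (inverse (of_int x ^ m) - inverse (of_int (x - int p) ^ m)
           + of_nat p * of_nat m * inverse (of_int x ^ Suc m))"
proof (rule pdivI)
  have y: "\<not> int p dvd x - int p"
    using assms(2) dvd_add[of "int p" "x - int p" "int p"] by auto
  show "\<not> int p dvd x ^ Suc m * (x - int p) ^ m"
    using assms y by (auto simp: prime_dvd_mult_iff dest!: prime_dvd_power[rotated])
  show "(int p)\<^sup>2 dvd (x + int p * int m) * (x - int p) ^ m - x ^ Suc m"
    by (rule inverse_power_expansion_mod_square)
  have nz: "(of_int x :: rat) \<noteq> 0" "(of_int (x - int p) :: rat) \<noteq> 0"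
    using assms(2) y by (auto simp del: of_int_diff)
  have "inverse (X ^ m) - inverse (Y ^ m) + c * inverse (X ^ Suc m)
      = ((X + c) * Y ^ m - X ^ Suc m) / (X ^ Suc m * Y ^ m)"
    if "X \<noteq> 0" "Y \<noteq> 0" for X Y c :: rat
    using that by (simp add: field_simps)
  from this[OF nz, of "of_nat p * of_nat m"]
  show "inverse (of_int x ^ m) - inverse (of_int (x - int p) ^ m)
           + of_nat p * of_nat m * inverse (of_int x ^ Suc m)
      = (of_int ((x + int p * int m) * (x - int p) ^ m - x ^ Suc m) :: rat)
        / of_int (x ^ Suc m * (x - int p) ^ m)"
    by simp
qed

text \<open>
  Summing the expansion of the shifted inverse powers over all residues expresses twice the harmonic
  number through \<open>p\<close> times the one of the next order. Oddness is what makes \<open>i - p\<close> contribute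
  the negative of the summand for \<open>p - i\<close>, so that the two copies add up instead of cancelling.
\<close>
lemma pdiv_2_gen_harmonic:
  fixes p m :: nat
  assumes "prime p" "odd m" "m + 2 < p"
  shows "pdiv p 2 (gen_harmonic (int m) (p - 1))"
proof -
  let ?H = "gen_harmonic (int m) (p - 1)"
  let ?H' = "gen_harmonic (int (Suc m)) (p - 1)"
  have "(\<Sum>i=1..p - 1. inverse (of_int (int i - int p) ^ m))
      = (\<Sum>i=1..p - 1. - inverse (of_nat (p - i) ^ m) :: rat)"
  proof (rule sum.cong)
    fix i assume "i \<in> {1..p - 1}"
    then have "i \<le> p"
      by auto
    then have eq: "of_int (int i - int p) = - (of_nat (p - i) :: rat)"
      by (simp add: of_nat_diff)
    show "inverse (of_int (int i - int p) ^ m) = - inverse (of_nat (p - i) ^ m :: rat)"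
      unfolding eq power_minus_odd[OF assms(2)] by (rule inverse_minus_eq)
  qed simp
  also have "\<dots> = - (\<Sum>i=1..p - 1. inverse (of_nat (p - i) ^ m))"
    by (rule sum_negf)
  also have "(\<Sum>i=1..p - 1. inverse (of_nat (p - i) ^ m)) = ?H"
    unfolding gen_harmonic_nat
    by (rule sum.reindex_bij_witness[of _ "\<lambda>i. p - i" "\<lambda>i. p - i"]) auto
  finally have refl: "(\<Sum>i=1..p - 1. inverse (of_int (int i - int p) ^ m)) = - ?H" .
  have "pdiv p 2 (\<Sum>i=1..p - 1. inverse (of_int (int i) ^ m) - inverse (of_int (int i - int p) ^ m)
           + of_nat p * of_nat m * inverse (of_int (int i) ^ Suc m))"
    by (intro pdiv_sum pdiv_2_inverse_power_shift assms(1)) (auto dest: dvd_imp_le)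
  also have "(\<Sum>i=1..p - 1. inverse (of_int (int i) ^ m) - inverse (of_int (int i - int p) ^ m)
           + of_nat p * of_nat m * inverse (of_int (int i) ^ Suc m))
      = ?H - (- ?H) + of_nat p * of_nat m * ?H'"
    unfolding sum.distrib sum_subtractf refl
    unfolding gen_harmonic_nat sum_distrib_left by simp
  finally have 1: "pdiv p 2 (?H - (- ?H) + of_nat p * of_nat m * ?H')" .
  have p2: "p \<ge> 2"
    using assms(3) by simp
  have "pdiv p 1 ?H'"
    by (rule pdiv_1_gen_harmonic) (use assms in auto)
  then have "pdiv p ((1 + 0) + 1) (of_nat p * of_int (int m) * ?H')"
    by (intro pdiv_mult assms(1) pdiv_prime pdiv_of_int p2)
  from pdiv_diff[OF assms(1) 1, OF this[simplified, folded numeral_2_eq_2]]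
  have "pdiv p 2 (of_int 2 * ?H)"
    by simp
  moreover have "\<not> int p dvd 2"
    using assms(3) by (auto dest: zdvd_imp_le)
  ultimately show ?thesis
    using pdiv_cancel[OF assms(1)] by blast
qed

section \<open>Summation by parts\<close>

text \<open>
  The telescoping sum of \<open>i H\<^sub>i\<^sup>2 - (i - 1) H\<^sub>i\<^sub>-\<^sub>1\<^sup>2\<close> leaves behind the sum of the products of \<open>H\<^sub>i\<close> with the
  inverse of \<open>i ^ a\<close>. That sum is half of \<open>H\<^sub>n\<^sup>2\<close> plus half of the harmonic number of order \<open>2 a\<close>, so the
  factor \<open>n\<close> becomes \<open>n + 1\<close> and the terms of order \<open>2 a\<close> cancel.
\<close>
lemma sum_gen_harmonic_square:
  assumes "a > 0"
  shows "(\<Sum>i=1..n. (gen_harmonic (int a) i)\<^sup>2)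
      + 2 * (\<Sum>i=1..n. of_nat i * inverse (of_nat i ^ a) * gen_harmonic (int a) i)
      = of_nat (Suc n) * (gen_harmonic (int a) n)\<^sup>2 + gen_harmonic (int (2 * a - 1)) n"
proof (induction n)
  case (Suc n)
  obtain b where b: "a = Suc b"
    using assms gr0_implies_Suc by blast
  define N :: rat where "N = of_nat (Suc n)"
  define u where "u = inverse (N ^ a)"
  define h where "h = gen_harmonic (int a) n"
  have "N \<noteq> 0"
    by (simp add: N_def del: of_nat_Suc)
  then have odd_part: "inverse (N ^ (2 * a - 1)) = N * u\<^sup>2"
    by (simp add: u_def b power2_eq_square mult_2 power_add)
  have H: "gen_harmonic (int a) (Suc n) = h + u"
    by (simp only: gen_harmonic_Suc h_def u_def N_def)
  have "N * h\<^sup>2 + ((h + u)\<^sup>2 + 2 * (N * u * (h + u))) = (N + 1) * (h + u)\<^sup>2 + N * u\<^sup>2"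
    by (simp add: algebra_simps power2_eq_square)
  moreover have "of_nat (Suc (Suc n)) = N + 1"
    by (simp add: N_def)
  moreover have "gen_harmonic (int (2 * a - 1)) (Suc n)
      = gen_harmonic (int (2 * a - 1)) n + N * u\<^sup>2"
    by (simp only: gen_harmonic_Suc odd_part[unfolded N_def] N_def)
  ultimately show ?case
    using Suc.IH
    by (simp add: H flip: N_def u_def h_def del: of_nat_Suc)
qed simp

theorem mainTheorem4:
  fixes a p :: nat
  assumes "a > 0"
    and "prime p"
    and "p \<ge> 2 * a + 2"
  shows "rat_cong p 2
    (\<Sum>i=1..p - 1. (gen_harmonic (int a) i)\<^sup>2)
    (- 2 * (\<Sum>i=1..p - 1. of_nat i powi (- int a + 1) * gen_harmonic (int a) i))"
proof -
  let ?H = "gen_harmonic (int a)"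
  let ?S = "\<Sum>i=1..p - 1. (?H i)\<^sup>2"
  let ?T = "\<Sum>i=1..p - 1. of_nat i * inverse (of_nat i ^ a) * ?H i"
  have p2: "p \<ge> 2"
    using assms(3) by simp
  have T: "(\<Sum>i=1..p - 1. of_nat i powi (- int a + 1) * ?H i) = ?T"
  proof (rule sum.cong)
    fix i assume "i \<in> {1..p - 1}"
    then have "(of_nat i :: rat) \<noteq> 0"
      by simp
    then have "(of_nat i :: rat) powi (- int a + 1) = of_nat i * inverse (of_nat i ^ a)"
      by (subst power_int_add) (simp_all add: power_int_minus)
    then show "of_nat i powi (- int a + 1) * ?H i = of_nat i * inverse (of_nat i ^ a) * ?H i"
      by simp
  qed simp
  have "pdiv p 0 ?T"
  proof (rule pdiv_sum[OF assms(2)])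
    fix i assume i: "i \<in> {1..p - 1}"
    then have "pdiv p 0 (?H i)"
      by (intro pdiv_gen_harmonic assms) auto
    then have "pdiv p (0 + 0 + 0) (of_int (int i) * inverse (of_nat i ^ a) * ?H i)"
      by (intro pdiv_mult assms pdiv_of_int p2 pdiv_inverse_power i)
    then show "pdiv p 0 (of_nat i * inverse (of_nat i ^ a) * ?H i)"
      by simp
  qed
  then have "pdiv p (0 + 0) (of_int (- 2) * ?T)"
    by (intro pdiv_mult assms pdiv_of_int p2)
  then have int: "pdiv p 0 (- 2 * ?T)"
    by simp
  have "pdiv p 1 (?H (p - 1))"
    by (rule pdiv_1_gen_harmonic) (use assms in auto)
  then have "pdiv p (0 + (1 + 1)) (of_int (int p) * (?H (p - 1) * ?H (p - 1)))"
    by (intro pdiv_mult pdiv_of_int assms p2)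
  then have "pdiv p 2 (of_nat p * (?H (p - 1))\<^sup>2)"
    by (simp add: power2_eq_square numeral_2_eq_2)
  moreover have "pdiv p 2 (gen_harmonic (int (2 * a - 1)) (p - 1))"
    by (rule pdiv_2_gen_harmonic) (use assms in auto)
  ultimately have "pdiv p 2 (of_nat p * (?H (p - 1))\<^sup>2 + gen_harmonic (int (2 * a - 1)) (p - 1))"
    by (intro pdiv_add assms)
  also have "of_nat p * (?H (p - 1))\<^sup>2 + gen_harmonic (int (2 * a - 1)) (p - 1) = ?S - (- 2 * ?T)"
    using sum_gen_harmonic_square[OF assms(1), of "p - 1"] p2 by simp
  finally show ?thesis
    unfolding T by (intro rat_congI assms int)
qed

end
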